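(* Let $C$ be a finite set of colours with $|C| = m$. Two finite $C$-coloured linear orders $A$ and $A'$ are $2$-equivalent if and only if there are a coloured $T$-configuration $T$ and a function $g$ (assigning to each pair $u<v$ of consecutive members of $T$ a set $g(u,v)\subseteq C$) such that $A$ and $A'$ both lie in $\mathcal{C}_{T,g}$.
   Context: A $C$-coloured linear order is a triple $(A,<,F)$ where $(A,<)$ is a linear order and $F$ is a map from $A$ onto the set $C$ of colours; here $m=|C|\ge 1$. In the $n$-move Ehrenfeucht-Fraïssé game on coloured linear orders $A$ and $B$, players I and II move alternately, I first; on each move I picks an element of either structure and II responds with an element of the other structure. After $n$ moves elements $a_1,\dots,a_n\in A$ and $b_1,\dots,b_n\in B$ have been chosen, and II wins if $a_i\mapsto b_i$ is an order- and colour-isomorphism. $A$ and $B$ are $n$-equivalent, $A\equiv_n B$, if II has a winning strategy. A $T$-configuration is a linear order $T=\{x_i:1\le i\le m\}\cup\{y_i:1\le i\le m\}$, considered together with the labelling of its points, in which $x_1<x_2<\dots<x_m$, $y_1>y_2>\dots>y_m$, and $x_1$ and $y_1$ are the least and greatest members of $T$ respectively (it is allowed that $x_i=y_j$ for some $i,j$). $T$-configurations are identified when there is an order-isomorphism preserving the labels. A coloured $T$-configuration is a $T$-configuration together with an assignment of a colour from $C$ to each of its points (identified when there is an isomorphism preserving labels and colours). If $(A,<,F)$ is a finite $C$-coloured linear order, its associated coloured $T$-configuration is the coloured linear order induced from $A$ on $\{x_i:1\le i\le m\}\cup\{y_i:1\le i\le m\}$, where $x_i$ is the least point $x$ of $A$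 such that $\{F(z):z\in A, z\le x\}$ has $i$ elements, and $y_i$ is the greatest point $y$ of $A$ such that $\{F(z):z\in A,z\ge y\}$ has $i$ elements. For a coloured $T$-configuration $T$ and a function $g$ assigning to each pair $u<v$ of consecutive members of $T$ a set of colours $g(u,v)$, $\mathcal{C}_{T,g}$ denotes the set of all finite $C$-coloured linear orders $A$ whose associated coloured $T$-configuration is $T$ and such that, for all consecutive members $u<v$ of $T$, the set of colours of the points of $A$ lying strictly between $u$ and $v$ is $g(u,v)$. *)

theory Defs
  imports Main
begin

section \<open>Coloured linear orders\<close>

text \<open>The relation \<open>lt\<close> is the strict order.\<close>

record ('a, 'c) col_order =
  pts :: "'a set"
  lt :: "('a \<times> 'a) set"
  col :: "'a \<Rightarrow> 'c"

definition linear_points :: "('a, 'c, 'z) col_order_scheme \<Rightarrow> bool" where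
  "linear_points A \<longleftrightarrow>
     lt A \<subseteq> pts A \<times> pts A \<and> strict_linear_order_on (pts A) (lt A)"

abbreviation le :: "('a, 'c, 'z) col_order_scheme \<Rightarrow> 'a \<Rightarrow> 'a \<Rightarrow> bool" where
  "le A u v \<equiv> u = v \<or> (u, v) \<in> lt A"

definition coloured_linear_order :: "'c set \<Rightarrow> ('a, 'c) col_order \<Rightarrow> bool" where
  "coloured_linear_order C A \<longleftrightarrow> linear_points A \<and> col A ` pts A = C"

definition consecutive :: "('a, 'c, 'z) col_order_scheme \<Rightarrow> 'a \<Rightarrow> 'a \<Rightarrow> bool" where
  "consecutive A u v \<longleftrightarrow> u \<in> pts A \<and> v \<in> pts A \<and> (u, v) \<in> lt A \<and>
     \<not> (\<exists>w \<in> pts A. (u, w) \<in> lt A \<and> (w, v) \<in> lt A)"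


section \<open>The Ehrenfeucht-Fraisse game\<close>

text \<open>A move of player I is \<open>Inl a\<close> (a point of the first structure) or \<open>Inr b\<close> (a point of
  the second one), and player II replies with the other injection. A strategy of player II maps
  the nonempty list of all moves made so far by player I, most recent last, to a reply. The
  earlier replies are determined by the strategy and so need not be recorded.\<close>

definition legal_move :: "('a, 'c) col_order \<Rightarrow> ('b, 'c) col_order \<Rightarrow> 'a + 'b \<Rightarrow> bool" where
  "legal_move A B p \<longleftrightarrow> p \<in> pts A <+> pts B"

definition legal_reply ::
    "('a, 'c) col_order \<Rightarrow> ('b, 'c) col_order \<Rightarrow> 'a + 'b \<Rightarrow> 'a + 'b \<Rightarrow> bool" where
  "legal_reply A B p q \<longleftrightarrow>
     (case p of Inl a \<Rightarrow> q \<in> Inr ` pts B | Inr b \<Rightarrow> q \<in> Inl ` pts A)"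

definition chosen_pair :: "'a + 'b \<Rightarrow> 'a + 'b \<Rightarrow> 'a \<times> 'b" where
  "chosen_pair p q = (case p of Inl a \<Rightarrow> (a, projr q) | Inr b \<Rightarrow> (projl q, b))"

definition partial_isomorphism ::
    "('a, 'c) col_order \<Rightarrow> ('b, 'c) col_order \<Rightarrow> ('a \<times> 'b) set \<Rightarrow> bool" where
  "partial_isomorphism A B P \<longleftrightarrow>
     (\<forall>(a, b) \<in> P. col A a = col B b) \<and>
     (\<forall>(a, b) \<in> P. \<forall>(a', b') \<in> P.
        (a = a' \<longleftrightarrow> b = b') \<and> ((a, a') \<in> lt A \<longleftrightarrow> (b, b') \<in> lt B))"

definition winning_strategy ::
    "nat \<Rightarrow> ('a, 'c) col_order \<Rightarrow> ('b, 'c) col_order \<Rightarrow> (('a + 'b) list \<Rightarrow> 'a + 'b) \<Rightarrow> bool" where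
  "winning_strategy n A B \<sigma> \<longleftrightarrow>
     (\<forall>ps. length ps = n \<and> (\<forall>p \<in> set ps. legal_move A B p) \<longrightarrow>
        (\<forall>k<n. legal_reply A B (ps ! k) (\<sigma> (take (Suc k) ps))) \<and>
        partial_isomorphism A B
          {chosen_pair (ps ! k) (\<sigma> (take (Suc k) ps)) | k. k < n})"

definition n_equivalent :: "nat \<Rightarrow> ('a, 'c) col_order \<Rightarrow> ('b, 'c) col_order \<Rightarrow> bool" where
  "n_equivalent n A B \<longleftrightarrow> (\<exists>\<sigma>. winning_strategy n A B \<sigma>)"


section \<open>Coloured T-configurations\<close>

text \<open>Only the values of the labellings on \<open>{1..m}\<close> are meaningful.\<close>

record ('a, 'c) T_conf = "('a, 'c) col_order" +
  xlab :: "nat \<Rightarrow> 'a"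
  ylab :: "nat \<Rightarrow> 'a"

definition T_configuration :: "nat \<Rightarrow> ('a, 'c) T_conf \<Rightarrow> bool" where
  "T_configuration m T \<longleftrightarrow>
     linear_points T \<and>
     pts T = xlab T ` {1..m} \<union> ylab T ` {1..m} \<and>
     (\<forall>i \<in> {1..m}. \<forall>j \<in> {1..m}. i < j \<longrightarrow>
        (xlab T i, xlab T j) \<in> lt T \<and> (ylab T j, ylab T i) \<in> lt T) \<and>
     (\<forall>t \<in> pts T. le T (xlab T 1) t \<and> le T t (ylab T 1))"

definition coloured_T_configuration :: "'c set \<Rightarrow> ('a, 'c) T_conf \<Rightarrow> bool" where
  "coloured_T_configuration C T \<longleftrightarrow> T_configuration (card C) T \<and> col T ` pts T \<subseteq> C"

definition T_conf_iso ::
    "nat \<Rightarrow> ('a \<Rightarrow> 'b) \<Rightarrow> ('a, 'c) T_conf \<Rightarrow> ('b, 'c) T_conf \<Rightarrow> bool" where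
  "T_conf_iso m \<phi> S T \<longleftrightarrow>
     bij_betw \<phi> (pts S) (pts T) \<and>
     (\<forall>u \<in> pts S. \<forall>v \<in> pts S. (u, v) \<in> lt S \<longleftrightarrow> (\<phi> u, \<phi> v) \<in> lt T) \<and>
     (\<forall>u \<in> pts S. col T (\<phi> u) = col S u) \<and>
     (\<forall>i \<in> {1..m}. \<phi> (xlab S i) = xlab T i \<and> \<phi> (ylab S i) = ylab T i)"

definition cols_upto :: "('a, 'c) col_order \<Rightarrow> 'a \<Rightarrow> 'c set" where
  "cols_upto A x = col A ` {z \<in> pts A. le A z x}"

definition cols_from :: "('a, 'c) col_order \<Rightarrow> 'a \<Rightarrow> 'c set" where
  "cols_from A y = col A ` {z \<in> pts A. le A y z}"

definition xpoint :: "('a, 'c) col_order \<Rightarrow> nat \<Rightarrow> 'a" where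
  "xpoint A i = (THE x. x \<in> pts A \<and> card (cols_upto A x) = i \<and>
     (\<forall>x' \<in> pts A. card (cols_upto A x') = i \<longrightarrow> le A x x'))"

definition ypoint :: "('a, 'c) col_order \<Rightarrow> nat \<Rightarrow> 'a" where
  "ypoint A i = (THE y. y \<in> pts A \<and> card (cols_from A y) = i \<and>
     (\<forall>y' \<in> pts A. card (cols_from A y') = i \<longrightarrow> le A y' y))"

definition associated_T_conf :: "nat \<Rightarrow> ('a, 'c) col_order \<Rightarrow> ('a, 'c) T_conf" where
  "associated_T_conf m A =
     (let P = xpoint A ` {1..m} \<union> ypoint A ` {1..m}
      in \<lparr>pts = P, lt = lt A \<inter> (P \<times> P), col = col A, xlab = xpoint A, ylab = ypoint A\<rparr>)"

text \<open>T-configurations are identified up to isomorphism, so ``the associated configuration of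
  \<open>A\<close> is \<open>T\<close>'' is witnessed by an isomorphism \<open>\<phi>\<close>, necessarily unique on the points of \<open>T\<close>,
  along which the consecutive pairs of \<open>T\<close> are read as pairs of points of \<open>A\<close>.\<close>

definition config_class ::
    "'c set \<Rightarrow> ('v, 'c) T_conf \<Rightarrow> ('v \<Rightarrow> 'v \<Rightarrow> 'c set) \<Rightarrow> ('a, 'c) col_order set" where
  "config_class C T g =
     {A. coloured_linear_order C A \<and> finite (pts A) \<and>
         (\<exists>\<phi>. T_conf_iso (card C) \<phi> T (associated_T_conf (card C) A) \<and>
              (\<forall>u v. consecutive T u v \<longrightarrow>
                 col A ` {z \<in> pts A. (\<phi> u, z) \<in> lt A \<and> (z, \<phi> v) \<in> lt A} = g u v))}"

end

theory Submission
  imports Defs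
begin

text \<open>
  Fix the first pair \<open>(a, b)\<close> of a two-move game. The second move can test nothing more than which
  colours occur to the left and which to the right of the first point, so II survives exactly
  when \<open>a\<close> and \<open>b\<close> have the same \<^emph>\<open>signature\<close>: the same colour, the same set of colours below and
  the same set of colours above. Hence two orders are 2-equivalent iff they realise the same
  signatures (\<open>n_equivalent_2_iff_signatures\<close>), and it remains to see that the set of realised
  signatures carries the same information as the coloured T-configuration together with the colours
  in its gaps.

  The bridge is that the signature of \<open>a\<close> amounts to its colour and its position relative to the
  points \<open>x\<^sub>i\<close> and \<open>y\<^sub>j\<close>. In one direction, \<open>x\<^sub>i \<le> a\<close> says that at least \<open>i\<close> colours occur up to and
  including \<open>a\<close>, and \<open>x\<^sub>i < a\<close> that at least \<open>i\<close> colours occur strictly below \<open>a\<close>; both are read off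
  the signature (\<open>same_signature_imp_same_position\<close>). In the other direction, the \<open>x\<^sub>i\<close> are precisely
  the first occurrences of the colours, so the colours below \<open>a\<close> are the colours of the \<open>x\<^sub>i < a\<close>
  (\<open>same_position_imp_same_signature\<close>). The \<open>y\<^sub>j\<close> are treated by reversing the order.

  If both orders realise the same signatures, a point with the signature of \<open>x\<^sub>i\<close> occupies the
  position of \<open>x\<^sub>i\<close> and so is the point \<open>x\<^sub>i\<close> of the other order; therefore the configurations are
  isomorphic, and points in a gap are answered by points in the corresponding gap
  (\<open>same_signatures_imp_common_class\<close>). Conversely, in a common class a point of the configuration is
  answered by the point with the same label, and any other point by a point of its colour in
  the corresponding gap; the position, hence the signature, is the same
  (\<open>common_class_imp_same_signature\<close>).
\<close>

section \<open>Two-move equivalence and signatures\<close>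

definition colours_below :: "('a, 'c) col_order \<Rightarrow> 'a \<Rightarrow> 'c set" where
  "colours_below A a = col A ` {z \<in> pts A. (z, a) \<in> lt A}"

definition colours_above :: "('a, 'c) col_order \<Rightarrow> 'a \<Rightarrow> 'c set" where
  "colours_above A a = col A ` {z \<in> pts A. (a, z) \<in> lt A}"

definition same_signature ::
    "('a, 'c) col_order \<Rightarrow> 'a \<Rightarrow> ('b, 'c) col_order \<Rightarrow> 'b \<Rightarrow> bool" where
  "same_signature A a B b \<longleftrightarrow>
     col A a = col B b \<and> colours_below A a = colours_below B b \<and> colours_above A a = colours_above B b"

lemma same_signature_commute: "same_signature A a B b \<longleftrightarrow> same_signature B b A a"
  by (auto simp: same_signature_def)

lemma setcompr_less_2: "{f k | k. k < (2::nat)} = {f 0, f 1}"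
  by (auto simp: less_2_cases_iff)

text \<open>Strategies are unfolded into alternating quantifiers over moves and replies; conversely the
  choices of replies are assembled into a strategy that looks at how many moves have been made.\<close>

lemma n_equivalent_2_iff_replies:
  "n_equivalent 2 A B \<longleftrightarrow>
     (\<forall>p. legal_move A B p \<longrightarrow> (\<exists>q. legal_reply A B p q \<and>
        (\<forall>r. legal_move A B r \<longrightarrow> (\<exists>s. legal_reply A B r s \<and>
           partial_isomorphism A B {chosen_pair p q, chosen_pair r s}))))"
  (is "?L \<longleftrightarrow> ?R")
proof
  assume ?L
  then obtain \<sigma> where \<sigma>: "winning_strategy 2 A B \<sigma>"
    by (auto simp: n_equivalent_def)
  have two: "legal_reply A B p (\<sigma> [p]) \<and> legal_reply A B r (\<sigma> [p, r]) \<and>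
      partial_isomorphism A B {chosen_pair p (\<sigma> [p]), chosen_pair r (\<sigma> [p, r])}"
    if "legal_move A B p" "legal_move A B r" for p r
  proof -
    have "{chosen_pair ([p, r] ! k) (\<sigma> (take (Suc k) [p, r])) | k. k < 2} =
        {chosen_pair p (\<sigma> [p]), chosen_pair r (\<sigma> [p, r])}"
      by (subst setcompr_less_2) simp
    moreover have "(\<forall>k<2. legal_reply A B ([p, r] ! k) (\<sigma> (take (Suc k) [p, r]))) \<and>
        partial_isomorphism A B {chosen_pair ([p, r] ! k) (\<sigma> (take (Suc k) [p, r])) | k. k < 2}"
      using \<sigma>[unfolded winning_strategy_def, rule_format, of "[p, r]"] that by simp
    ultimately show ?thesis
      by (auto simp: less_2_cases_iff)
  qed
  show ?R
  proof (intro allI impI)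
    fix p assume p: "legal_move A B p"
    show "\<exists>q. legal_reply A B p q \<and> (\<forall>r. legal_move A B r \<longrightarrow> (\<exists>s. legal_reply A B r s \<and>
           partial_isomorphism A B {chosen_pair p q, chosen_pair r s}))"
      using two[OF p] p by (intro exI[of _ "\<sigma> [p]"]) blast
  qed
next
  assume ?R
  then obtain q where q: "\<And>p. legal_move A B p \<Longrightarrow> legal_reply A B p (q p) \<and>
        (\<forall>r. legal_move A B r \<longrightarrow> (\<exists>s. legal_reply A B r s \<and>
           partial_isomorphism A B {chosen_pair p (q p), chosen_pair r s}))"
    by metis
  then obtain s where s: "\<And>p r. legal_move A B p \<Longrightarrow> legal_move A B r \<Longrightarrow>
        legal_reply A B r (s p r) \<and>
           partial_isomorphism A B {chosen_pair p (q p), chosen_pair r (s p r)}"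
    by metis
  define \<sigma> where "\<sigma> ps = (if length ps = 1 then q (ps ! 0) else s (ps ! 0) (ps ! 1))" for ps
  have "winning_strategy 2 A B \<sigma>"
    unfolding winning_strategy_def
  proof (intro allI impI)
    fix ps assume ps: "length ps = 2 \<and> (\<forall>p \<in> set ps. legal_move A B p)"
    then obtain p r where pr: "ps = [p, r]"
      by (auto simp: numeral_2_eq_2 length_Suc_conv)
    have "{chosen_pair (ps ! k) (\<sigma> (take (Suc k) ps)) | k. k < 2} =
        {chosen_pair p (q p), chosen_pair r (s p r)}"
      by (subst setcompr_less_2) (simp add: pr \<sigma>_def)
    then show "(\<forall>k<2. legal_reply A B (ps ! k) (\<sigma> (take (Suc k) ps))) \<and>
        partial_isomorphism A B {chosen_pair (ps ! k) (\<sigma> (take (Suc k) ps)) | k. k < 2}"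
      using ps q[of p] s[of p r] by (auto simp: pr less_2_cases_iff \<sigma>_def)
  qed
  then show ?L by (auto simp: n_equivalent_def)
qed

text \<open>Quantification over a move and its reply splits into the back and the forth condition, in terms
  of the pair chosen alone.\<close>

lemma all_moves_iff:
  "(\<forall>p. legal_move A B p \<longrightarrow> (\<exists>q. legal_reply A B p q \<and> P (chosen_pair p q))) \<longleftrightarrow>
     (\<forall>a \<in> pts A. \<exists>b \<in> pts B. P (a, b)) \<and> (\<forall>b \<in> pts B. \<exists>a \<in> pts A. P (a, b))"
proof -
  have "(\<exists>q. legal_reply A B (Inl a) q \<and> P (chosen_pair (Inl a) q)) \<longleftrightarrow> (\<exists>b \<in> pts B. P (a, b))" for a
    by (force simp: legal_reply_def chosen_pair_def)
  moreover have
    "(\<exists>q. legal_reply A B (Inr b) q \<and> P (chosen_pair (Inr b) q)) \<longleftrightarrow> (\<exists>a \<in> pts A. P (a, b))" for b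
    by (force simp: legal_reply_def chosen_pair_def)
  ultimately show ?thesis
    by (simp add: split_sum_all legal_move_def Ball_def Plus_def image_iff)
qed

lemma partial_isomorphism_two_pairs:
  assumes "linear_points A" "linear_points B"
  shows "partial_isomorphism A B {(a, b), (z, w)} \<longleftrightarrow>
     col A a = col B b \<and> col A z = col B w \<and> (a = z \<longleftrightarrow> b = w) \<and>
     ((a, z) \<in> lt A \<longleftrightarrow> (b, w) \<in> lt B) \<and> ((z, a) \<in> lt A \<longleftrightarrow> (w, b) \<in> lt B)"
proof -
  have "\<And>z. (z, z) \<notin> lt A" "\<And>z. (z, z) \<notin> lt B"
    using assms unfolding linear_points_def strict_linear_order_on_def irrefl_def by blast+
  then show ?thesis by (auto simp: partial_isomorphism_def)
qed

text \<open>II answers a second move below (above) the first point by a point of the same colour below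
  (above) the other first point, and answers a repetition by a repetition.\<close>

lemma same_signature_reply:
  assumes "linear_points A" "linear_points B" "a \<in> pts A" "b \<in> pts B"
    and sig: "same_signature A a B b" and z: "z \<in> pts A"
  shows "\<exists>w \<in> pts B. partial_isomorphism A B {(a, b), (z, w)}"
proof -
  have A: "\<And>z. (z, z) \<notin> lt A" "\<And>y z. (y, z) \<in> lt A \<Longrightarrow> (z, y) \<notin> lt A"
    "z = a \<or> (z, a) \<in> lt A \<or> (a, z) \<in> lt A"
    using assms
    unfolding linear_points_def strict_linear_order_on_def trans_def irrefl_def total_on_def
    by blast+
  have B: "\<And>z. (z, z) \<notin> lt B" "\<And>y z. (y, z) \<in> lt B \<Longrightarrow> (z, y) \<notin> lt B"
    using assms
    unfolding linear_points_def strict_linear_order_on_def trans_def irrefl_def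
    by blast+
  have c: "col A a = col B b" using sig by (simp add: same_signature_def)
  note two_pairs = partial_isomorphism_two_pairs[OF assms(1,2)]
  consider "z = a" | "(z, a) \<in> lt A" | "(a, z) \<in> lt A" using A(3) by blast
  then show ?thesis
  proof cases
    case 1 then show ?thesis using c assms A(1) B(1) unfolding two_pairs by blast
  next
    case 2
    then have "col A z \<in> colours_below B b"
      using sig z by (auto simp: same_signature_def colours_below_def)
    then obtain w where "w \<in> pts B" "(w, b) \<in> lt B" "col A z = col B w"
      by (auto simp: colours_below_def)
    then show ?thesis using 2 A(1,2) B(1,2) c unfolding two_pairs by metis
  next
    case 3
    then have "col A z \<in> colours_above B b"
      using sig z by (auto simp: same_signature_def colours_above_def)
    then obtain w where "w \<in> pts B" "(b, w) \<in> lt B" "col A z = col B w"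
      by (auto simp: colours_above_def)
    then show ?thesis using 3 A(1,2) B(1,2) c unfolding two_pairs by metis
  qed
qed

text \<open>For the converse, second moves by I in either order exhibit every colour that occurs on the left or on the
  right of one first point, and the answers show that it also occurs on that side of the other one.\<close>

lemma same_signature_iff_replies:
  assumes "linear_points A" "linear_points B" "a \<in> pts A" "b \<in> pts B"
  shows "same_signature A a B b \<longleftrightarrow>
     (\<forall>z \<in> pts A. \<exists>w \<in> pts B. partial_isomorphism A B {(a, b), (z, w)}) \<and>
     (\<forall>w \<in> pts B. \<exists>z \<in> pts A. partial_isomorphism A B {(a, b), (z, w)})"
  (is "?L \<longleftrightarrow> ?R1 \<and> ?R2")
proof -
  note two_pairs = partial_isomorphism_two_pairs[OF assms(1,2)]
  show ?thesis
  proof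
    assume ?L
    then have ?R1 using same_signature_reply[OF assms] by blast
    moreover have ?R2
      using same_signature_reply[OF assms(2,1,4,3) same_signature_commute[THEN iffD1, OF \<open>?L\<close>]]
      unfolding two_pairs partial_isomorphism_two_pairs[OF assms(2,1)] by metis
    ultimately show "?R1 \<and> ?R2" by blast
  next
    assume R: "?R1 \<and> ?R2"
    then have c: "col A a = col B b" using assms(3) unfolding two_pairs by blast
    have "colours_below A a = colours_below B b"
      using R unfolding colours_below_def two_pairs by (fastforce simp: image_iff set_eq_iff)
    moreover have "colours_above A a = colours_above B b"
      using R unfolding colours_above_def two_pairs by (fastforce simp: image_iff set_eq_iff)
    ultimately show ?L using c by (simp add: same_signature_def)
  qed
qed

lemma n_equivalent_2_iff_signatures:
  assumes "linear_points A" "linear_points B"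
  shows "n_equivalent 2 A B \<longleftrightarrow>
     (\<forall>a \<in> pts A. \<exists>b \<in> pts B. same_signature A a B b) \<and>
     (\<forall>b \<in> pts B. \<exists>a \<in> pts A. same_signature A a B b)"
proof -
  define P where "P x \<longleftrightarrow>
      (\<forall>z \<in> pts A. \<exists>w \<in> pts B. partial_isomorphism A B {x, (z, w)}) \<and>
      (\<forall>w \<in> pts B. \<exists>z \<in> pts A. partial_isomorphism A B {x, (z, w)})" for x
  have P: "P (a, b) \<longleftrightarrow> same_signature A a B b" if "a \<in> pts A" "b \<in> pts B" for a b
    unfolding P_def using same_signature_iff_replies[OF assms that] by (rule sym)
  have "n_equivalent 2 A B \<longleftrightarrow>
      (\<forall>p. legal_move A B p \<longrightarrow> (\<exists>q. legal_reply A B p q \<and> P (chosen_pair p q)))"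
    unfolding n_equivalent_2_iff_replies P_def
      all_moves_iff[of A B "\<lambda>x. partial_isomorphism A B {chosen_pair p q, x}" for p q] ..
  also have "\<dots> \<longleftrightarrow> (\<forall>a \<in> pts A. \<exists>b \<in> pts B. P (a, b)) \<and> (\<forall>b \<in> pts B. \<exists>a \<in> pts A. P (a, b))"
    by (rule all_moves_iff)
  also have "\<dots> \<longleftrightarrow> (\<forall>a \<in> pts A. \<exists>b \<in> pts B. same_signature A a B b) \<and>
      (\<forall>b \<in> pts B. \<exists>a \<in> pts A. same_signature A a B b)"
    using P by blast
  finally show ?thesis .
qed

section \<open>First and last occurrences of colours\<close>

locale finite_coloured_order =
  fixes C :: "'c set" and A :: "('a, 'c) col_order"
  assumes coloured: "coloured_linear_order C A" and finite_pts: "finite (pts A)"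
begin

lemma linear: "linear_points A"
  using coloured by (simp add: coloured_linear_order_def)

lemma lt_pts: "(x, y) \<in> lt A \<Longrightarrow> x \<in> pts A \<and> y \<in> pts A"
  using linear by (auto simp: linear_points_def)

lemma lt_trans: "(x, y) \<in> lt A \<Longrightarrow> (y, z) \<in> lt A \<Longrightarrow> (x, z) \<in> lt A"
  using linear unfolding linear_points_def strict_linear_order_on_def trans_def by blast

lemma lt_irrefl: "(x, x) \<notin> lt A"
  using linear unfolding linear_points_def strict_linear_order_on_def irrefl_def by blast

lemma lt_total: "x \<in> pts A \<Longrightarrow> y \<in> pts A \<Longrightarrow> x = y \<or> (x, y) \<in> lt A \<or> (y, x) \<in> lt A"
  using linear unfolding linear_points_def strict_linear_order_on_def total_on_def by blast

lemma le_lt_trans: "le A x y \<Longrightarrow> (y, z) \<in> lt A \<Longrightarrow> (x, z) \<in> lt A"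
  using lt_trans by blast

lemma lt_le_trans: "(x, y) \<in> lt A \<Longrightarrow> le A y z \<Longrightarrow> (x, z) \<in> lt A"
  using lt_trans by blast

lemma le_imp_not_gt: "le A x y \<Longrightarrow> (y, x) \<notin> lt A"
  using lt_irrefl lt_trans by blast

lemma acyclic_lt: "acyclic (lt A)"
proof -
  have "trans (lt A)" using lt_trans by (rule transI)
  then show ?thesis by (simp add: acyclic_def lt_irrefl)
qed

lemma finite_lt: "finite (lt A)"
  by (rule finite_subset[of _ "pts A \<times> pts A"]) (use lt_pts finite_pts in auto)

lemma ex_least:
  assumes "z \<in> S" "S \<subseteq> pts A"
  obtains x where "x \<in> S" "\<And>y. y \<in> S \<Longrightarrow> le A x y"
proof -
  have "wf (lt A)" using finite_lt acyclic_lt by (rule finite_acyclic_wf)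
  then obtain x where x: "x \<in> S" "\<And>y. (y, x) \<in> lt A \<Longrightarrow> y \<notin> S"
    using assms(1) by (auto elim: wfE_min)
  then have "le A x y" if "y \<in> S" for y using that assms lt_total by blast
  then show ?thesis using x that by blast
qed

lemma ex_greatest:
  assumes "z \<in> S" "S \<subseteq> pts A"
  obtains x where "x \<in> S" "\<And>y. y \<in> S \<Longrightarrow> le A y x"
proof -
  have "wf ((lt A)\<inverse>)" using finite_lt acyclic_lt by (rule finite_acyclic_wf_converse)
  then obtain x where x: "x \<in> S" "\<And>y. (y, x) \<in> (lt A)\<inverse> \<Longrightarrow> y \<notin> S"
    using assms(1) by (auto elim: wfE_min)
  then have "le A y x" if "y \<in> S" for y using that assms lt_total by blast
  then show ?thesis using x that by blast
qed

lemma finite_cols: "finite (cols_upto A x)" "finite (colours_below A x)"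
  using finite_pts by (auto simp: cols_upto_def colours_below_def)

lemma cols_upto_eq: "x \<in> pts A \<Longrightarrow> cols_upto A x = insert (col A x) (colours_below A x)"
  by (auto simp: cols_upto_def colours_below_def)

lemma cols_upto_mono: "le A x y \<Longrightarrow> cols_upto A x \<subseteq> cols_upto A y"
  unfolding cols_upto_def using lt_trans by blast

lemma cols_upto_subset_below: "(x, y) \<in> lt A \<Longrightarrow> cols_upto A x \<subseteq> colours_below A y"
  unfolding cols_upto_def colours_below_def using lt_trans by blast

text \<open>If anything lies below \<open>a\<close>, finiteness gives an immediate predecessor of \<open>a\<close>, which turns the strict notion into the
  reflexive one.\<close>

lemma below_eq_cols_upto:
  assumes "colours_below A a \<noteq> {}"
  obtains p where "(p, a) \<in> lt A" "colours_below A a = cols_upto A p"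
proof -
  obtain z where "z \<in> {z \<in> pts A. (z, a) \<in> lt A}"
    using assms by (auto simp: colours_below_def)
  then obtain p where p: "p \<in> {z \<in> pts A. (z, a) \<in> lt A}"
      "\<And>y. y \<in> {z \<in> pts A. (z, a) \<in> lt A} \<Longrightarrow> le A y p"
    by (rule ex_greatest[of z]) auto
  have "colours_below A a \<subseteq> cols_upto A p"
    using p by (auto simp: colours_below_def cols_upto_def)
  then show ?thesis using that cols_upto_subset_below p by blast
qed

text \<open>The least \<open>x\<close> with at least \<open>i\<close> colours up to \<open>x\<close> has exactly \<open>i\<close>: fewer than \<open>i\<close> occur below it,
  and \<open>x\<close> itself contributes at most one.\<close>

lemma xpoint_exists:
  assumes i: "1 \<le> i" "i \<le> card C"
  shows "\<exists>x. x \<in> pts A \<and> card (cols_upto A x) = i \<and>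
     (\<forall>x' \<in> pts A. card (cols_upto A x') = i \<longrightarrow> le A x x')"
proof -
  let ?S = "{x \<in> pts A. i \<le> card (cols_upto A x)}"
  have C: "C = col A ` pts A" using coloured by (simp add: coloured_linear_order_def)
  then obtain z where z: "z \<in> pts A" using i by fastforce
  obtain g where g: "g \<in> pts A" "\<And>y. y \<in> pts A \<Longrightarrow> le A y g"
    using ex_greatest[OF z] by blast
  then have "cols_upto A g = C" by (auto simp: C cols_upto_def)
  then have "g \<in> ?S" using g i by simp
  then obtain x where x: "x \<in> ?S" and least: "\<And>y. y \<in> ?S \<Longrightarrow> le A x y"
    by (rule ex_least) auto
  have "card (colours_below A x) < i"
  proof (cases "colours_below A x = {}")
    case False
    then obtain p where p: "(p, x) \<in> lt A" "colours_below A x = cols_upto A p"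
      by (rule below_eq_cols_upto)
    then have "p \<notin> ?S" using least[of p] lt_trans lt_irrefl by blast
    then show ?thesis using p lt_pts by auto
  qed (use i in simp)
  then have "card (cols_upto A x) \<le> i"
    using x finite_cols by (simp add: cols_upto_eq card_insert_if)
  then show ?thesis using x least by fastforce
qed

lemma xpoint:
  assumes "1 \<le> i" "i \<le> card C"
  shows "xpoint A i \<in> pts A" "card (cols_upto A (xpoint A i)) = i"
    "\<And>x'. x' \<in> pts A \<Longrightarrow> card (cols_upto A x') = i \<Longrightarrow> le A (xpoint A i) x'"
proof -
  have "\<exists>!x. x \<in> pts A \<and> card (cols_upto A x) = i \<and>
     (\<forall>x' \<in> pts A. card (cols_upto A x') = i \<longrightarrow> le A x x')"
    using xpoint_exists[OF assms] lt_irrefl lt_trans by blast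
  from theI'[OF this, folded xpoint_def]
  show "xpoint A i \<in> pts A" "card (cols_upto A (xpoint A i)) = i"
    "\<And>x'. x' \<in> pts A \<Longrightarrow> card (cols_upto A x') = i \<Longrightarrow> le A (xpoint A i) x'"
    by blast+
qed

text \<open>This and \<open>xpoint_lt_iff\<close> express comparisons with the \<open>x\<^sub>i\<close> by numbers of colours, and thus make
  them visible in the signature.\<close>

lemma xpoint_le_iff:
  assumes "1 \<le> i" "i \<le> card C" "a \<in> pts A"
  shows "le A (xpoint A i) a \<longleftrightarrow> i \<le> card (cols_upto A a)"
proof
  assume "le A (xpoint A i) a"
  then show "i \<le> card (cols_upto A a)"
    using card_mono[OF finite_cols(1) cols_upto_mono] xpoint(2)[OF assms(1,2)] by metis
next
  assume i: "i \<le> card (cols_upto A a)"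
  show "le A (xpoint A i) a"
  proof (rule ccontr)
    assume n: "\<not> le A (xpoint A i) a"
    then have "(a, xpoint A i) \<in> lt A" using assms xpoint(1) lt_total by blast
    then have "card (cols_upto A a) \<le> i"
      using card_mono[OF finite_cols(1) cols_upto_mono] xpoint(2)[OF assms(1,2)] by metis
    then show False using i n assms xpoint(3) by fastforce
  qed
qed

lemma xpoint_lt_iff:
  assumes "1 \<le> i" "i \<le> card C" "a \<in> pts A"
  shows "(xpoint A i, a) \<in> lt A \<longleftrightarrow> i \<le> card (colours_below A a)"
proof
  assume "(xpoint A i, a) \<in> lt A"
  then show "i \<le> card (colours_below A a)"
    using card_mono[OF finite_cols(2) cols_upto_subset_below] xpoint(2)[OF assms(1,2)] by metis
next
  assume i: "i \<le> card (colours_below A a)"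
  then have "colours_below A a \<noteq> {}" using assms(1) by auto
  then obtain p where p: "(p, a) \<in> lt A" "colours_below A a = cols_upto A p"
    by (rule below_eq_cols_upto)
  then have "le A (xpoint A i) p" using i assms lt_pts by (subst xpoint_le_iff) auto
  then show "(xpoint A i, a) \<in> lt A" using p lt_trans by blast
qed

text \<open>If \<open>i\<close> colours occur up to \<open>z\<close> and the one of \<open>z\<close> is new, then only \<open>i - 1\<close> colours occur below
  \<open>z\<close>, so that \<open>x\<^sub>i \<le> z\<close> but not \<open>x\<^sub>i < z\<close>.\<close>

lemma first_occurrence_is_xpoint:
  assumes z: "z \<in> pts A" "col A z \<notin> colours_below A z"
  obtains i where "1 \<le> i" "i \<le> card C" "xpoint A i = z"
proof -
  let ?i = "card (cols_upto A z)"
  have card: "?i = Suc (card (colours_below A z))"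
    using z finite_cols by (simp add: cols_upto_eq)
  have "cols_upto A z \<subseteq> C" "finite C"
    using coloured finite_pts by (auto simp: coloured_linear_order_def cols_upto_def)
  then have i: "1 \<le> ?i" "?i \<le> card C" using card card_mono[of C "cols_upto A z"] by simp_all
  then have "le A (xpoint A ?i) z" using xpoint_le_iff z by blast
  moreover have "(xpoint A ?i, z) \<notin> lt A" using xpoint_lt_iff[OF i z(1)] card by simp
  ultimately show ?thesis using i that by blast
qed

text \<open>A colour occurs below \<open>a\<close> iff its first occurrence lies below \<open>a\<close>, and first occurrences are
  among the \<open>x\<^sub>i\<close>.\<close>

lemma below_eq_xpoints:
  "colours_below A a = col A ` xpoint A ` {i \<in> {1..card C}. (xpoint A i, a) \<in> lt A}"
proof
  show "col A ` xpoint A ` {i \<in> {1..card C}. (xpoint A i, a) \<in> lt A} \<subseteq> colours_below A a"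
    using lt_pts by (auto simp: colours_below_def)
  show "colours_below A a \<subseteq> col A ` xpoint A ` {i \<in> {1..card C}. (xpoint A i, a) \<in> lt A}"
  proof
    fix c assume "c \<in> colours_below A a"
    then obtain y where y: "y \<in> {y \<in> pts A. col A y = c}" "(y, a) \<in> lt A"
      by (auto simp: colours_below_def)
    from y(1) obtain z where z: "z \<in> {y \<in> pts A. col A y = c}"
        "\<And>y. y \<in> {y \<in> pts A. col A y = c} \<Longrightarrow> le A z y"
      by (rule ex_least) auto
    have "col A z \<notin> colours_below A z"
    proof
      assume "col A z \<in> colours_below A z"
      then obtain w where "w \<in> pts A" "(w, z) \<in> lt A" "col A w = c"
        using z(1) by (auto simp: colours_below_def)
      then show False using z(2)[of w] lt_irrefl lt_trans by blast
    qed
    then obtain i where i: "1 \<le> i" "i \<le> card C" "xpoint A i = z"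
      using first_occurrence_is_xpoint z(1) by blast
    moreover have "(z, a) \<in> lt A" using z(2)[OF y(1)] y(2) lt_trans by blast
    ultimately show "c \<in> col A ` xpoint A ` {i \<in> {1..card C}. (xpoint A i, a) \<in> lt A}"
      using z(1) by force
  qed
qed

lemma xpoint_strict_mono:
  assumes "1 \<le> i" "i < j" "j \<le> card C"
  shows "(xpoint A i, xpoint A j) \<in> lt A"
proof -
  have "le A (xpoint A i) (xpoint A j)"
    using assms xpoint(1,2)[of j] by (subst xpoint_le_iff) auto
  moreover have "xpoint A i \<noteq> xpoint A j"
    using assms xpoint(2)[of i] xpoint(2)[of j] by auto
  ultimately show ?thesis by blast
qed

lemma xpoint_1_le:
  assumes "a \<in> pts A" "1 \<le> card C"
  shows "le A (xpoint A 1) a"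
proof -
  have "card (cols_upto A a) \<noteq> 0" using finite_cols assms by (simp add: cols_upto_eq)
  then show ?thesis using assms by (subst xpoint_le_iff) auto
qed

end

section \<open>Last occurrences by reversing the order\<close>

definition reversed :: "('a, 'c) col_order \<Rightarrow> ('a, 'c) col_order" where
  "reversed A = A\<lparr>lt := (lt A)\<inverse>\<rparr>"

lemma reversed_simps:
  "pts (reversed A) = pts A" "lt (reversed A) = (lt A)\<inverse>" "col (reversed A) = col A"
  by (simp_all add: reversed_def)

lemma cols_upto_reversed: "cols_upto (reversed A) = cols_from A"
  by (auto simp: fun_eq_iff cols_upto_def cols_from_def reversed_simps)

lemma below_reversed: "colours_below (reversed A) = colours_above A"
  by (auto simp: fun_eq_iff colours_below_def colours_above_def reversed_simps)

lemma xpoint_reversed: "xpoint (reversed A) = ypoint A"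
  by (auto simp: fun_eq_iff xpoint_def ypoint_def cols_upto_reversed reversed_simps
      intro!: arg_cong[of _ _ The])

context finite_coloured_order
begin

lemma reversed: "finite_coloured_order C (reversed A)"
proof
  show "coloured_linear_order C (reversed A)"
    using coloured
    by (auto simp: coloured_linear_order_def linear_points_def strict_linear_order_on_def
        reversed_simps)
  show "finite (pts (reversed A))" using finite_pts by (simp add: reversed_simps)
qed

lemmas reversed_rewrites =
  reversed_simps cols_upto_reversed below_reversed xpoint_reversed converse_iff

lemmas cols_from_eq = finite_coloured_order.cols_upto_eq[OF reversed, unfolded reversed_rewrites]
lemmas ypoint_in = finite_coloured_order.xpoint(1)[OF reversed, unfolded reversed_rewrites]
lemmas ypoint_ge_iff =
  finite_coloured_order.xpoint_le_iff[OF reversed, unfolded reversed_rewrites]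
lemmas ypoint_gt_iff =
  finite_coloured_order.xpoint_lt_iff[OF reversed, unfolded reversed_rewrites]
lemmas above_eq_ypoints =
  finite_coloured_order.below_eq_xpoints[OF reversed, unfolded reversed_rewrites]
lemmas ypoint_strict_anti =
  finite_coloured_order.xpoint_strict_mono[OF reversed, unfolded reversed_rewrites]
lemmas le_ypoint_1 =
  finite_coloured_order.xpoint_1_le[OF reversed, unfolded reversed_rewrites]

end

section \<open>Signatures as positions relative to the marked points\<close>

text \<open>The tag \<open>Inl i\<close> stands for the label \<open>x\<^sub>i\<close> and \<open>Inr j\<close> for \<open>y\<^sub>j\<close>, so that both kinds of points of
  a configuration are handled at once.\<close>

definition labels :: "nat \<Rightarrow> (nat + nat) set" where
  "labels m = {1..m} <+> {1..m}"

definition mark :: "('a, 'c) col_order \<Rightarrow> nat + nat \<Rightarrow> 'a" where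
  "mark A = case_sum (xpoint A) (ypoint A)"

text \<open>For points of linear orders this also determines which marked points lie above
  (\<open>same_position_gt\<close>).\<close>

definition same_position ::
    "nat \<Rightarrow> ('a, 'c) col_order \<Rightarrow> 'a \<Rightarrow> ('b, 'c) col_order \<Rightarrow> 'b \<Rightarrow> bool" where
  "same_position m A a B b \<longleftrightarrow>
     (\<forall>t \<in> labels m. ((mark A t, a) \<in> lt A \<longleftrightarrow> (mark B t, b) \<in> lt B) \<and>
        (mark A t = a \<longleftrightarrow> mark B t = b))"

lemma mark_simps: "mark A (Inl i) = xpoint A i" "mark A (Inr i) = ypoint A i"
  by (simp_all add: mark_def)

lemma labels_cases:
  assumes "t \<in> labels m"
  obtains i where "t = Inl i" "1 \<le> i" "i \<le> m" | i where "t = Inr i" "1 \<le> i" "i \<le> m"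
  using assms by (auto simp: labels_def)

lemma labels_iff: "Inl i \<in> labels m \<longleftrightarrow> 1 \<le> i \<and> i \<le> m" "Inr i \<in> labels m \<longleftrightarrow> 1 \<le> i \<and> i \<le> m"
  by (auto simp: labels_def)

lemma (in finite_coloured_order) mark_in: "t \<in> labels (card C) \<Longrightarrow> mark A t \<in> pts A"
  by (auto elim!: labels_cases simp: mark_simps xpoint(1) ypoint_in)

locale two_coloured_orders =
  A: finite_coloured_order C A + B: finite_coloured_order C B
  for C :: "'c set" and A :: "('a, 'c) col_order" and B :: "('b, 'c) col_order"
begin

lemma swapped: "two_coloured_orders C B A"
  by unfold_locales

text \<open>The two sets of colours in a signature, with the colour of the point added or not, determine all
  the numbers of colours that decide the comparisons with the marked points.\<close>

lemma same_signature_imp_same_position: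
  assumes "a \<in> pts A" "b \<in> pts B" and sig: "same_signature A a B b"
  shows "same_position (card C) A a B b"
  unfolding same_position_def
proof
  have upto: "cols_upto A a = cols_upto B b" "cols_from A a = cols_from B b"
    using assms
    by (simp_all add: A.cols_upto_eq B.cols_upto_eq A.cols_from_eq B.cols_from_eq
        same_signature_def)
  fix t assume "t \<in> labels (card C)"
  then show "((mark A t, a) \<in> lt A \<longleftrightarrow> (mark B t, b) \<in> lt B) \<and> (mark A t = a \<longleftrightarrow> mark B t = b)"
  proof (cases rule: labels_cases)
    case (1 i)
    have "(xpoint A i, a) \<in> lt A \<longleftrightarrow> (xpoint B i, b) \<in> lt B"
      using 1 assms by (simp add: A.xpoint_lt_iff B.xpoint_lt_iff same_signature_def)
    moreover have "le A (xpoint A i) a \<longleftrightarrow> le B (xpoint B i) b"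
      using 1 assms upto by (simp add: A.xpoint_le_iff B.xpoint_le_iff)
    ultimately show ?thesis using 1 A.lt_irrefl B.lt_irrefl by (auto simp: mark_simps)
  next
    case (2 i)
    have gt: "(a, ypoint A i) \<in> lt A \<longleftrightarrow> (b, ypoint B i) \<in> lt B"
      using 2 assms by (simp add: A.ypoint_gt_iff B.ypoint_gt_iff same_signature_def)
    have "ypoint A i = a \<or> (a, ypoint A i) \<in> lt A \<longleftrightarrow> ypoint B i = b \<or> (b, ypoint B i) \<in> lt B"
      using 2 assms upto by (simp add: A.ypoint_ge_iff B.ypoint_ge_iff)
    then have eq: "ypoint A i = a \<longleftrightarrow> ypoint B i = b"
      using gt A.lt_irrefl B.lt_irrefl by auto
    have "(ypoint A i, a) \<in> lt A \<longleftrightarrow> (ypoint B i, b) \<in> lt B"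
      using gt eq A.lt_total[OF A.ypoint_in[of i] assms(1)] B.lt_total[OF B.ypoint_in[of i] assms(2)]
        A.lt_irrefl B.lt_irrefl A.lt_trans B.lt_trans 2 by metis
    then show ?thesis using eq 2 by (simp add: mark_simps)
  qed
qed

lemma same_position_gt:
  assumes "a \<in> pts A" "b \<in> pts B" "same_position (card C) A a B b" "t \<in> labels (card C)"
  shows "(a, mark A t) \<in> lt A \<longleftrightarrow> (b, mark B t) \<in> lt B"
  using assms A.lt_total[OF A.mark_in[OF assms(4)] assms(1)]
    B.lt_total[OF B.mark_in[OF assms(4)] assms(2)]
    A.lt_irrefl B.lt_irrefl A.lt_trans B.lt_trans
  unfolding same_position_def by metis

text \<open>The colours on either side of a point are those of the marked points \<open>x\<^sub>i\<close>, respectively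
  \<open>y\<^sub>j\<close>, on that side.\<close>

lemma same_position_imp_same_signature:
  assumes "a \<in> pts A" "b \<in> pts B" and pos: "same_position (card C) A a B b"
    and "col A a = col B b"
    and marks: "\<And>t. t \<in> labels (card C) \<Longrightarrow> col A (mark A t) = col B (mark B t)"
  shows "same_signature A a B b"
proof -
  have "{i \<in> {1..card C}. (xpoint A i, a) \<in> lt A} = {i \<in> {1..card C}. (xpoint B i, b) \<in> lt B}"
    using pos unfolding same_position_def by (force simp: labels_iff simp flip: mark_simps)
  then have "colours_below A a = colours_below B b"
    unfolding A.below_eq_xpoints B.below_eq_xpoints image_image
    by (rule image_cong) (use marks[of "Inl _"] in \<open>simp add: labels_iff mark_simps\<close>)
  moreover have "{i \<in> {1..card C}. (a, ypoint A i) \<in> lt A} = {i \<in> {1..card C}. (b, ypoint B i) \<in> lt B}"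
    using same_position_gt[OF assms(1-3), of "Inr _"] by (auto simp: labels_iff mark_simps)
  then have "colours_above A a = colours_above B b"
    unfolding A.above_eq_ypoints B.above_eq_ypoints image_image
    by (rule image_cong) (use marks[of "Inr _"] in \<open>simp add: labels_iff mark_simps\<close>)
  ultimately show ?thesis using assms(4) by (simp add: same_signature_def)
qed

end

section \<open>Configurations\<close>

definition lab :: "('v, 'c) T_conf \<Rightarrow> nat + nat \<Rightarrow> 'v" where
  "lab T = case_sum (xlab T) (ylab T)"

lemma T_configuration_pts: "T_configuration m T \<Longrightarrow> pts T = lab T ` labels m"
  by (auto simp: T_configuration_def labels_def lab_def Plus_def image_Un image_image)

lemma associated_T_conf_simps:
  "pts (associated_T_conf m A) = mark A ` labels m"
  "lt (associated_T_conf m A) = lt A \<inter> (mark A ` labels m \<times> mark A ` labels m)"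
  "col (associated_T_conf m A) = col A"
  "xlab (associated_T_conf m A) = xpoint A"
  "ylab (associated_T_conf m A) = ypoint A"
proof -
  have "mark A ` labels m = xpoint A ` {1..m} \<union> ypoint A ` {1..m}"
    by (auto simp: labels_def mark_def Plus_def image_Un image_image)
  then show "pts (associated_T_conf m A) = mark A ` labels m"
    "lt (associated_T_conf m A) = lt A \<inter> (mark A ` labels m \<times> mark A ` labels m)"
    "col (associated_T_conf m A) = col A"
    "xlab (associated_T_conf m A) = xpoint A"
    "ylab (associated_T_conf m A) = ypoint A"
    by (simp_all add: associated_T_conf_def)
qed

lemma T_conf_iso_lab:
  assumes "T_conf_iso m \<phi> T (associated_T_conf m A)" "t \<in> labels m"
  shows "\<phi> (lab T t) = mark A t"
  using assms
  by (auto elim!: labels_cases simp: T_conf_iso_def associated_T_conf_simps lab_def mark_def)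

lemma T_conf_iso_associated:
  assumes \<phi>: "T_conf_iso m \<phi> T (associated_T_conf m A)" and T: "pts T = lab T ` labels m"
    and t: "t \<in> labels m"
  shows "s \<in> labels m \<Longrightarrow> (lab T s, lab T t) \<in> lt T \<longleftrightarrow> (mark A s, mark A t) \<in> lt A"
    and "s \<in> labels m \<Longrightarrow> lab T s = lab T t \<longleftrightarrow> mark A s = mark A t"
    and "col A (mark A t) = col T (lab T t)"
proof -
  note lab = T_conf_iso_lab[OF \<phi>]
  have inj: "inj_on \<phi> (pts T)"
    and lt: "\<And>u v. u \<in> pts T \<Longrightarrow> v \<in> pts T \<Longrightarrow>
      (u, v) \<in> lt T \<longleftrightarrow> (\<phi> u, \<phi> v) \<in> lt (associated_T_conf m A)"
    and col: "\<And>u. u \<in> pts T \<Longrightarrow> col A (\<phi> u) = col T u"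
    using \<phi> by (auto simp: T_conf_iso_def bij_betw_def associated_T_conf_simps)
  have tT: "lab T t \<in> pts T" using t T by blast
  show "col A (mark A t) = col T (lab T t)" using col[OF tT] lab[OF t] by simp
  assume s: "s \<in> labels m"
  then have sT: "lab T s \<in> pts T" using T by blast
  show "(lab T s, lab T t) \<in> lt T \<longleftrightarrow> (mark A s, mark A t) \<in> lt A"
    using lt[OF sT tT] lab s t by (simp add: associated_T_conf_simps)
  show "lab T s = lab T t \<longleftrightarrow> mark A s = mark A t"
    using inj_on_eq_iff[OF inj sT tT] lab s t by simp
qed

lemma T_conf_iso_trans:
  assumes "T_conf_iso m \<phi> R S" "T_conf_iso m \<psi> S T"
  shows "T_conf_iso m (\<psi> \<circ> \<phi>) R T"
proof -
  have "bij_betw (\<psi> \<circ> \<phi>) (pts R) (pts T)"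
    using assms by (auto simp: T_conf_iso_def intro: bij_betw_trans)
  moreover have "\<phi> u \<in> pts S" if "u \<in> pts R" for u
    using assms(1) that by (auto simp: T_conf_iso_def bij_betw_def)
  ultimately show ?thesis using assms by (simp add: T_conf_iso_def)
qed

text \<open>The configuration of \<open>A\<close> consists of points of \<open>A\<close>; to compare orders over different types it is
  moved along an injection into the natural numbers.\<close>

lemma nat_copy_of_configuration:
  fixes S :: "('a, 'c) T_conf"
  assumes S: "coloured_T_configuration C S" and "finite (pts S)"
  obtains T :: "(nat, 'c) T_conf" and \<phi>
  where "coloured_T_configuration C T" "T_conf_iso (card C) \<phi> T S"
proof -
  obtain f :: "'a \<Rightarrow> nat" where f: "inj_on f (pts S)"
    using finite_imp_inj_to_nat_seg[OF assms(2)] by blast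
  define \<phi> where "\<phi> = inv_into (pts S) f"
  have \<phi>f: "\<phi> (f u) = u" if "u \<in> pts S" for u
    using f that by (simp add: \<phi>_def)
  define T where "T = \<lparr>pts = f ` pts S,
      lt = {(u, v). u \<in> f ` pts S \<and> v \<in> f ` pts S \<and> (\<phi> u, \<phi> v) \<in> lt S},
      col = col S \<circ> \<phi>, xlab = f \<circ> xlab S, ylab = f \<circ> ylab S\<rparr>"
  have T: "pts T = f ` pts S" "xlab T = f \<circ> xlab S" "ylab T = f \<circ> ylab S" "col T = col S \<circ> \<phi>"
    and ltT: "\<And>u v. (u, v) \<in> lt T \<longleftrightarrow> u \<in> f ` pts S \<and> v \<in> f ` pts S \<and> (\<phi> u, \<phi> v) \<in> lt S"
    by (simp_all add: T_def)
  let ?m = "card C"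
  have TS: "T_configuration ?m S" using S by (simp add: coloured_T_configuration_def)
  then have lin: "linear_points S" by (simp add: T_configuration_def)
  have labs: "xlab S i \<in> pts S" "ylab S i \<in> pts S" if "i \<in> {1..?m}" for i
    using that TS by (auto simp: T_configuration_def)
  have "linear_points T"
    using lin \<phi>f
    unfolding linear_points_def strict_linear_order_on_def trans_def irrefl_def total_on_def
    by (auto simp: ltT T)
  moreover have "pts T = xlab T ` {1..?m} \<union> ylab T ` {1..?m}"
    using TS by (simp add: T_configuration_def T image_Un image_comp)
  moreover have "\<forall>i \<in> {1..?m}. \<forall>j \<in> {1..?m}. i < j \<longrightarrow>
        (xlab T i, xlab T j) \<in> lt T \<and> (ylab T j, ylab T i) \<in> lt T"
    using TS labs unfolding T_configuration_def by (simp add: T ltT \<phi>f)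
  moreover have "le T (xlab T 1) t \<and> le T t (ylab T 1)" if t: "t \<in> pts T" for t
  proof -
    obtain u where u: "u \<in> pts S" "t = f u" using t unfolding T by blast
    moreover have "u \<in> xlab S ` {1..?m} \<union> ylab S ` {1..?m}"
      using u(1) TS by (simp add: T_configuration_def)
    then have "1 \<in> {1..?m}" by auto
    moreover have "le S (xlab S 1) u \<and> le S u (ylab S 1)"
      using TS u by (simp add: T_configuration_def)
    ultimately show ?thesis using labs[of 1] by (auto simp: T ltT \<phi>f)
  qed
  ultimately have "T_configuration ?m T" by (simp add: T_configuration_def)
  moreover have "col T ` pts T \<subseteq> C"
    using S by (auto simp: coloured_T_configuration_def T \<phi>f)
  ultimately have "coloured_T_configuration C T" by (simp add: coloured_T_configuration_def)
  moreover have "T_conf_iso ?m \<phi> T S"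
    unfolding T_conf_iso_def
  proof (intro conjI)
    show "bij_betw \<phi> (pts T) (pts S)"
      using f by (simp add: \<phi>_def T bij_betw_inv_into inj_on_imp_bij_betw)
  qed (use labs in \<open>auto simp: T ltT \<phi>f\<close>)
  ultimately show ?thesis using that by blast
qed

context finite_coloured_order
begin

lemma associated_coloured_T_configuration:
  "coloured_T_configuration C (associated_T_conf (card C) A)" (is "coloured_T_configuration C ?S")
proof -
  let ?m = "card C"
  have "linear_points ?S"
    using lt_irrefl lt_trans lt_total mark_in
    unfolding linear_points_def strict_linear_order_on_def trans_def irrefl_def total_on_def
      associated_T_conf_simps
    by blast
  moreover have "pts ?S = xlab ?S ` {1..?m} \<union> ylab ?S ` {1..?m}"
    by (simp add: associated_T_conf_def)
  moreover have "\<forall>i \<in> {1..?m}. \<forall>j \<in> {1..?m}. i < j \<longrightarrow>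
        (xlab ?S i, xlab ?S j) \<in> lt ?S \<and> (ylab ?S j, ylab ?S i) \<in> lt ?S"
    by (simp add: associated_T_conf_def xpoint_strict_mono ypoint_strict_anti)
  moreover have "le ?S (xlab ?S 1) t \<and> le ?S t (ylab ?S 1)" if "t \<in> pts ?S" for t
  proof -
    have "1 \<le> ?m" "t \<in> pts A"
      using that mark_in by (auto simp: associated_T_conf_simps labels_def)
    then show ?thesis
      using that xpoint_1_le[of t] le_ypoint_1[of t]
      by (auto simp: associated_T_conf_def)
  qed
  ultimately have "T_configuration ?m ?S" by (simp add: T_configuration_def)
  moreover have "col ?S ` pts ?S \<subseteq> C"
    using mark_in coloured by (auto simp: associated_T_conf_simps coloured_linear_order_def)
  ultimately show ?thesis by (simp add: coloured_T_configuration_def)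
qed

end

context two_coloured_orders
begin

text \<open>Being the marked point with label \<open>t\<close> is a matter of position and hence of the signature, so the only
  candidate in \<open>B\<close> for a point with the signature of \<open>mark A t\<close> is \<open>mark B t\<close>.\<close>

lemma marks_same_signature:
  assumes "\<forall>a \<in> pts A. \<exists>b \<in> pts B. same_signature A a B b" and t: "t \<in> labels (card C)"
  shows "same_signature A (mark A t) B (mark B t)"
proof -
  obtain b where b: "b \<in> pts B" "same_signature A (mark A t) B b"
    using assms A.mark_in by blast
  then have "same_position (card C) A (mark A t) B b"
    using same_signature_imp_same_position A.mark_in[OF t] by blast
  then have "mark B t = b" using t unfolding same_position_def by blast
  then show ?thesis using b by simp
qed

lemma same_signatures_imp_isomorphic_configurations:
  assumes "\<forall>a \<in> pts A. \<exists>b \<in> pts B. same_signature A a B b"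
  obtains \<theta> where
    "T_conf_iso (card C) \<theta> (associated_T_conf (card C) A) (associated_T_conf (card C) B)"
proof -
  let ?L = "labels (card C)"
  have sig: "same_signature A (mark A t) B (mark B t)" if "t \<in> ?L" for t
    using marks_same_signature[OF assms that] .
  have pos: "same_position (card C) A (mark A t) B (mark B t)" if "t \<in> ?L" for t
    using same_signature_imp_same_position[OF A.mark_in B.mark_in sig] that by blast
  then have eq: "mark A s = mark A t \<longleftrightarrow> mark B s = mark B t"
    and lt: "(mark A s, mark A t) \<in> lt A \<longleftrightarrow> (mark B s, mark B t) \<in> lt B"
    if "s \<in> ?L" "t \<in> ?L" for s t
    using that by (simp_all add: same_position_def)
  \<comment> \<open>A point can carry two labels; \<open>eq\<close> shows that the choice of the label is immaterial.\<close>
  define \<theta> where "\<theta> a = mark B (SOME t. t \<in> ?L \<and> mark A t = a)" for a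
  have \<theta>: "\<theta> (mark A t) = mark B t" if "t \<in> ?L" for t
  proof -
    have "(SOME s. s \<in> ?L \<and> mark A s = mark A t) \<in> ?L \<and>
        mark A (SOME s. s \<in> ?L \<and> mark A s = mark A t) = mark A t"
      by (rule someI[of _ t]) (use that in simp)
    then show ?thesis using eq that unfolding \<theta>_def by blast
  qed
  have "bij_betw \<theta> (mark A ` ?L) (mark B ` ?L)"
    by (rule bij_betw_imageI) (auto simp: inj_on_def \<theta> eq image_image)
  moreover have "\<forall>i \<in> {1..card C}. \<theta> (xpoint A i) = xpoint B i \<and> \<theta> (ypoint A i) = ypoint B i"
    using \<theta>[of "Inl _"] \<theta>[of "Inr _"] by (simp add: labels_iff mark_simps)
  ultimately have
    "T_conf_iso (card C) \<theta> (associated_T_conf (card C) A) (associated_T_conf (card C) B)"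
    using sig
    by (auto simp: T_conf_iso_def associated_T_conf_simps \<theta> lt same_signature_def)
  then show ?thesis using that by blast
qed

text \<open>A point with the same signature lies in the same gap, since its position is the same.\<close>

lemma gap_colours_subset:
  assumes "\<forall>a \<in> pts A. \<exists>b \<in> pts B. same_signature A a B b"
    and s: "s \<in> labels (card C)" and t: "t \<in> labels (card C)"
  shows "col A ` {z \<in> pts A. (mark A s, z) \<in> lt A \<and> (z, mark A t) \<in> lt A} \<subseteq>
     col B ` {z \<in> pts B. (mark B s, z) \<in> lt B \<and> (z, mark B t) \<in> lt B}"
proof
  fix c assume "c \<in> col A ` {z \<in> pts A. (mark A s, z) \<in> lt A \<and> (z, mark A t) \<in> lt A}"
  then obtain z where z: "z \<in> pts A" "(mark A s, z) \<in> lt A" "(z, mark A t) \<in> lt A" "c = col A z"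
    by blast
  then obtain w where w: "w \<in> pts B" "same_signature A z B w" using assms(1) by blast
  have pos: "same_position (card C) A z B w"
    using same_signature_imp_same_position z w by blast
  have "(mark B s, w) \<in> lt B" using pos s z by (simp add: same_position_def)
  moreover have "(w, mark B t) \<in> lt B" using same_position_gt[OF z(1) w(1) pos t] z by simp
  moreover have "c = col B w" using z w by (simp add: same_signature_def)
  ultimately show "c \<in> col B ` {z \<in> pts B. (mark B s, z) \<in> lt B \<and> (z, mark B t) \<in> lt B}"
    using w by blast
qed

lemma same_signatures_imp_common_class:
  assumes AB: "\<forall>a \<in> pts A. \<exists>b \<in> pts B. same_signature A a B b"
    and BA: "\<forall>b \<in> pts B. \<exists>a \<in> pts A. same_signature A a B b"
  obtains T :: "(nat, 'c) T_conf" and g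
  where "coloured_T_configuration C T" "\<forall>u v. g u v \<subseteq> C"
    "A \<in> config_class C T g" "B \<in> config_class C T g"
proof -
  let ?m = "card C"
  have "finite (pts (associated_T_conf ?m A))"
    by (simp add: associated_T_conf_def)
  then obtain T :: "(nat, 'c) T_conf" and \<phi> where T: "coloured_T_configuration C T"
    and \<phi>: "T_conf_iso ?m \<phi> T (associated_T_conf ?m A)"
    using nat_copy_of_configuration[OF A.associated_coloured_T_configuration] by blast
  obtain \<theta> where "T_conf_iso ?m \<theta> (associated_T_conf ?m A) (associated_T_conf ?m B)"
    using same_signatures_imp_isomorphic_configurations[OF AB] .
  with \<phi> have \<psi>: "T_conf_iso ?m (\<theta> \<circ> \<phi>) T (associated_T_conf ?m B)"
    by (rule T_conf_iso_trans)
  define g where "g u v = col A ` {z \<in> pts A. (\<phi> u, z) \<in> lt A \<and> (z, \<phi> v) \<in> lt A}" for u v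
  have BA': "\<forall>b \<in> pts B. \<exists>a \<in> pts A. same_signature B b A a"
    using BA unfolding same_signature_commute[of B _ A] .
  have "col B ` {z \<in> pts B. ((\<theta> \<circ> \<phi>) u, z) \<in> lt B \<and> (z, (\<theta> \<circ> \<phi>) v) \<in> lt B} = g u v"
    if "consecutive T u v" for u v
  proof -
    have "pts T = lab T ` labels ?m"
      using T by (simp add: coloured_T_configuration_def T_configuration_pts)
    moreover have "u \<in> pts T" "v \<in> pts T" using that by (simp_all add: consecutive_def)
    ultimately obtain s t
      where st: "s \<in> labels ?m" "t \<in> labels ?m" and uv: "u = lab T s" "v = lab T t"
      by blast
    have eqs: "\<phi> u = mark A s" "\<phi> v = mark A t" "(\<theta> \<circ> \<phi>) u = mark B s" "(\<theta> \<circ> \<phi>) v = mark B t"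
      using T_conf_iso_lab[OF \<phi>] T_conf_iso_lab[OF \<psi>] st by (simp_all add: uv)
    show ?thesis
      unfolding g_def eqs
      by (rule subset_antisym[OF two_coloured_orders.gap_colours_subset[OF swapped BA' st]
            gap_colours_subset[OF AB st]])
  qed
  then have "B \<in> config_class C T g"
    unfolding config_class_def using \<psi> B.coloured B.finite_pts
    by (intro CollectI conjI exI[of _ "\<theta> \<circ> \<phi>"]) simp_all
  moreover have "A \<in> config_class C T g"
    unfolding config_class_def using \<phi> A.coloured A.finite_pts
    by (intro CollectI conjI exI[of _ \<phi>]) (simp_all add: g_def)
  moreover have "\<forall>u v. g u v \<subseteq> C"
    using A.coloured by (auto simp: g_def coloured_linear_order_def)
  ultimately show ?thesis using that T by blast
qed

text \<open>A point of the configuration is answered by the point with the same label. Any other point lies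
  strictly between two consecutive points of the configuration, as \<open>x\<^sub>1\<close> and \<open>y\<^sub>1\<close> are the ends of the
  whole order, and is answered by a point of its colour in the same gap of \<open>B\<close>.\<close>

lemma common_class_imp_same_signature:
  fixes T :: "('v, 'c) T_conf"
  assumes T: "coloured_T_configuration C T" and "1 \<le> card C"
    and "A \<in> config_class C T g" "B \<in> config_class C T g" and a: "a \<in> pts A"
  shows "\<exists>b \<in> pts B. same_signature A a B b"
proof -
  let ?m = "card C" and ?L = "labels (card C)"
  obtain \<phi> where \<phi>: "T_conf_iso ?m \<phi> T (associated_T_conf ?m A)"
    and gA: "\<And>u v. consecutive T u v \<Longrightarrow>
      col A ` {z \<in> pts A. (\<phi> u, z) \<in> lt A \<and> (z, \<phi> v) \<in> lt A} = g u v"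
    using assms(3) unfolding config_class_def by blast
  obtain \<psi> where \<psi>: "T_conf_iso ?m \<psi> T (associated_T_conf ?m B)"
    and gB: "\<And>u v. consecutive T u v \<Longrightarrow>
      col B ` {z \<in> pts B. (\<psi> u, z) \<in> lt B \<and> (z, \<psi> v) \<in> lt B} = g u v"
    using assms(4) unfolding config_class_def by blast
  note lab\<phi> = T_conf_iso_lab[OF \<phi>] and lab\<psi> = T_conf_iso_lab[OF \<psi>]
  have ptsT: "pts T = lab T ` ?L"
    using T T_configuration_pts by (auto simp: coloured_T_configuration_def)
  note isoA = T_conf_iso_associated[OF \<phi> ptsT] and isoB = T_conf_iso_associated[OF \<psi> ptsT]
  have lt: "(mark A s, mark A t) \<in> lt A \<longleftrightarrow> (mark B s, mark B t) \<in> lt B"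
    and eq: "mark A s = mark A t \<longleftrightarrow> mark B s = mark B t"
    if "s \<in> ?L" "t \<in> ?L" for s t
    using isoA(1,2)[OF that(2,1)] isoB(1,2)[OF that(2,1)] by simp_all
  have col: "col A (mark A t) = col B (mark B t)" if "t \<in> ?L" for t
    using isoA(3)[OF that] isoB(3)[OF that] by simp
  have "\<exists>b \<in> pts B. same_position ?m A a B b \<and> col A a = col B b"
  proof (cases "a \<in> mark A ` ?L")
    case True
    then obtain t where t: "t \<in> ?L" "a = mark A t" by blast
    then have "same_position ?m A a B (mark B t)"
      using lt eq by (simp add: same_position_def)
    moreover have "col A a = col B (mark B t)" using t col by simp
    ultimately show ?thesis using t B.mark_in by blast
  next
    case False
    have "Inl 1 \<in> ?L" "Inr 1 \<in> ?L" using assms(2) by (simp_all add: labels_iff)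
    then have ends: "xpoint A 1 \<in> mark A ` ?L" "ypoint A 1 \<in> mark A ` ?L"
      by (metis imageI mark_simps)+
    have P: "mark A ` ?L \<subseteq> pts A" using A.mark_in by blast
    have "xpoint A 1 \<in> {p \<in> mark A ` ?L. (p, a) \<in> lt A}"
      using A.xpoint_1_le[OF a assms(2)] False ends by blast
    then obtain u where "u \<in> {p \<in> mark A ` ?L. (p, a) \<in> lt A}"
        and u_max: "\<And>p. p \<in> {p \<in> mark A ` ?L. (p, a) \<in> lt A} \<Longrightarrow> le A p u"
      by (rule A.ex_greatest) (use P in blast)+
    then obtain s where s: "s \<in> ?L" "u = mark A s" "(mark A s, a) \<in> lt A" by blast
    have "ypoint A 1 \<in> {p \<in> mark A ` ?L. (a, p) \<in> lt A}"
      using A.le_ypoint_1[OF a assms(2)] False ends by blast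
    then obtain v where "v \<in> {p \<in> mark A ` ?L. (a, p) \<in> lt A}"
        and v_min: "\<And>p. p \<in> {p \<in> mark A ` ?L. (a, p) \<in> lt A} \<Longrightarrow> le A v p"
      by (rule A.ex_least) (use P in blast)+
    then obtain t where t: "t \<in> ?L" "v = mark A t" "(a, mark A t) \<in> lt A" by blast
    \<comment> \<open>No marked point lies strictly between \<open>u\<close> and \<open>v\<close>, the neighbours of \<open>a\<close>.\<close>
    have side: "le A (mark A r) (mark A s) \<or> le A (mark A t) (mark A r)" if r: "r \<in> ?L" for r
    proof -
      have "mark A r \<noteq> a" using r False by blast
      then consider "(mark A r, a) \<in> lt A" | "(a, mark A r) \<in> lt A"
        using A.lt_total[OF A.mark_in[OF r] a] by blast
      then show ?thesis
      proof cases
        case 1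
        then have "le A (mark A r) u" using r by (intro u_max) simp
        then show ?thesis by (simp add: s(2))
      next
        case 2
        then have "le A v (mark A r)" using r by (intro v_min) simp
        then show ?thesis by (simp add: t(2))
      qed
    qed
    have "consecutive T (lab T s) (lab T t)"
      unfolding consecutive_def ptsT
    proof (intro conjI notI)
      show "(lab T s, lab T t) \<in> lt T" 
        using isoA(1)[OF t(1) s(1)] A.lt_trans[OF s(3) t(3)] by simp
      assume "\<exists>w \<in> lab T ` ?L. (lab T s, w) \<in> lt T \<and> (w, lab T t) \<in> lt T"
      then obtain r where r: "r \<in> ?L"
          "(lab T s, lab T r) \<in> lt T" "(lab T r, lab T t) \<in> lt T"
        by blast
      then have "(mark A s, mark A r) \<in> lt A" "(mark A r, mark A t) \<in> lt A"
        using isoA(1)[OF r(1) s(1)] isoA(1)[OF t(1) r(1)] by simp_all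
      then show False using side[OF r(1)] A.le_imp_not_gt by blast
    qed (use s t in auto)
    note consecutive = this
    have "col A ` {z \<in> pts A. (mark A s, z) \<in> lt A \<and> (z, mark A t) \<in> lt A} =
        col B ` {z \<in> pts B. (mark B s, z) \<in> lt B \<and> (z, mark B t) \<in> lt B}"
      using gA[OF consecutive] gB[OF consecutive] lab\<phi> lab\<psi> s(1) t(1) by simp
    moreover have "col A a \<in> col A ` {z \<in> pts A. (mark A s, z) \<in> lt A \<and> (z, mark A t) \<in> lt A}"
      using a s t by blast
    ultimately have "col A a \<in> col B ` {z \<in> pts B. (mark B s, z) \<in> lt B \<and> (z, mark B t) \<in> lt B}"
      by simp
    then obtain b where b: "b \<in> pts B" "(mark B s, b) \<in> lt B" "(b, mark B t) \<in> lt B"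
        "col A a = col B b"
      by blast
    have "((mark A r, a) \<in> lt A \<longleftrightarrow> (mark B r, b) \<in> lt B) \<and> (mark A r = a \<longleftrightarrow> mark B r = b)"
      if r: "r \<in> ?L" for r
    proof -
      consider "le A (mark A r) (mark A s)" | "le A (mark A t) (mark A r)" using side[OF r] by blast
      then show ?thesis
      proof cases
        case 1
        then have "le B (mark B r) (mark B s)"
          using lt[OF r s(1)] eq[OF r s(1)] by simp
        then have "(mark B r, b) \<in> lt B" using b(2) by (rule B.le_lt_trans)
        moreover have "(mark A r, a) \<in> lt A" using 1 s(3) by (rule A.le_lt_trans)
        ultimately show ?thesis using A.lt_irrefl B.lt_irrefl by auto
      next
        case 2
        then have "le B (mark B t) (mark B r)"
          using lt[OF t(1) r] eq[OF t(1) r] by simp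
        with b(3) have "(b, mark B r) \<in> lt B" by (rule B.lt_le_trans)
        moreover have "(a, mark A r) \<in> lt A" using t(3) 2 by (rule A.lt_le_trans)
        ultimately show ?thesis using A.le_imp_not_gt B.le_imp_not_gt by blast
      qed
    qed
    then show ?thesis using b by (auto simp: same_position_def)
  qed
  then show ?thesis
    using same_position_imp_same_signature[OF a] col by blast
qed

end

theorem theorem2p2:
  fixes C :: "'c set" and m :: nat
    and A :: "('a, 'c) col_order" and A' :: "('b, 'c) col_order"
  assumes "finite C" and "card C = m" and "m \<ge> 1"
    and "coloured_linear_order C A" and "finite (pts A)"
    and "coloured_linear_order C A'" and "finite (pts A')"
  shows "n_equivalent 2 A A' \<longleftrightarrow>
    (\<exists>(T :: (nat, 'c) T_conf) (g :: nat \<Rightarrow> nat \<Rightarrow> 'c set).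
       coloured_T_configuration C T \<and>
       (\<forall>u v. consecutive T u v \<longrightarrow> g u v \<subseteq> C) \<and>
       A \<in> config_class C T g \<and> A' \<in> config_class C T g)"
  (is "_ \<longleftrightarrow> ?common_class")
proof -
  interpret two_coloured_orders C A A'
    using assms by unfold_locales
  have C: "1 \<le> card C" using assms by simp
  note signatures = n_equivalent_2_iff_signatures[OF A.linear B.linear]
  show ?thesis
  proof
    assume "n_equivalent 2 A A'"
    then show ?common_class
      unfolding signatures by (elim conjE same_signatures_imp_common_class) blast+
  next
    assume ?common_class
    then obtain T :: "(nat, 'c) T_conf" and g where T: "coloured_T_configuration C T"
      "A \<in> config_class C T g" "A' \<in> config_class C T g"
      by blast
    show "n_equivalent 2 A A'"
      unfolding signatures
      using common_class_imp_same_signature[OF T(1) C T(2,3)]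
        two_coloured_orders.common_class_imp_same_signature[OF swapped T(1) C T(3,2)]
      unfolding same_signature_commute[of A' _ A] by blast
  qed
qed

end
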